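(* Let $m\ge 1$ and $n$ be integers with $n\ge 8m$. Then, for the card guessing game with Yes/No feedback played with a uniformly shuffled deck of $mn$ cards consisting of $m$ copies of each of $n$ card types: (1) under the optimal strategy, $\mathbb{E}[S_{m,n}]\ge m+\frac{1}{40}\sqrt{m}$, i.e. $\max_{\mathcal{G}}\mathbb{E}[S(\mathcal{G},\boldsymbol{\pi})]\ge m+\frac{1}{40}\sqrt{m}$; (2) under the optimal misère strategy, $\mathbb{E}[S_{m,n}]\le m-\frac{1}{40}\sqrt{m}$, i.e. $\min_{\mathcal{G}}\mathbb{E}[S(\mathcal{G},\boldsymbol{\pi})]\le m-\frac{1}{40}\sqrt{m}$. Here the maximum and minimum range over all strategies $\mathcal{G}$ with Yes/No feedback.
   Context: Let $[n]=\{1,\dots,n\}$ and let $\mathfrak{S}_{m,n}$ be the set of all words $\pi=\pi_1\pi_2\cdots\pi_{mn}$ containing exactly $m$ copies of each element of $[n]$ (a shuffled deck of $mn$ cards with $n$ card types, each of multiplicity $m$). Let $\boldsymbol{\pi}$ be a uniformly random element of $\mathfrak{S}_{m,n}$. In the Yes/No feedback game, at each time $t=1,\dots,mn$ the player guesses the value of $\pi_t$ by naming an element of $[n]$, and is then told only whether the guess was correct or not. A strategy $\mathcal{G}$ with Yes/No feedback is a rule determining each guess from the feedback received so far, i.e. a sequence of functions $g_t:\{0,1\}^{t-1}\to[n]$, $1\le t\le mn$, where the guess at time $t$ is $g_t(x_1,\dots,x_{t-1})$ and $x_s=1$ if the $s$th guess was correct and $x_s=0$ otherwise. $S(\mathcal{G},\pi)$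 is the total number of correct guesses when strategy $\mathcal{G}$ is used on $\pi$, and $S_{m,n}=S(\mathcal{G},\boldsymbol{\pi})$ for the strategy in question. An optimal strategy is one attaining $\max_{\mathcal{G}}\mathbb{E}[S(\mathcal{G},\boldsymbol{\pi})]$; an optimal misère strategy is one attaining $\min_{\mathcal{G}}\mathbb{E}[S(\mathcal{G},\boldsymbol{\pi})]$. *)

theory Defs
  imports "HOL-Probability.Probability"
begin

definition decks :: "nat \<Rightarrow> nat \<Rightarrow> nat list set" where
  "decks m n = {\<pi>. length \<pi> = m * n \<and> set \<pi> \<subseteq> {1..n} \<and> (\<forall>i\<in>{1..n}. count_list \<pi> i = m)}"

text \<open>A strategy is a family of maps \<open>g t : {0,1}^(t-1) \<rightarrow> [n]\<close> for \<open>1 \<le> t \<le> mn\<close>, the feedback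
  bits being booleans. The extensional function spaces make distinct members differ as strategies,
  so that there are only finitely many.\<close>

definition strategies :: "nat \<Rightarrow> nat \<Rightarrow> (nat \<Rightarrow> bool list \<Rightarrow> nat) set" where
  "strategies m n = (\<Pi>\<^sub>E t\<in>{1..m * n}. {xs. length xs = t - 1} \<rightarrow>\<^sub>E {1..n})"

text \<open>\<open>feedback g \<pi> t\<close> is the list \<open>x\<^sub>1, \<dots>, x\<^sub>t\<close>. Times start at 1 but list positions at 0,
  so the card at time \<open>Suc t\<close> is \<open>\<pi> ! t\<close>.\<close>

primrec feedback :: "(nat \<Rightarrow> bool list \<Rightarrow> nat) \<Rightarrow> nat list \<Rightarrow> nat \<Rightarrow> bool list" where
  "feedback g \<pi> 0 = []"
| "feedback g \<pi> (Suc t) = feedback g \<pi> t @ [g (Suc t) (feedback g \<pi> t) = \<pi> ! t]"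

definition score :: "(nat \<Rightarrow> bool list \<Rightarrow> nat) \<Rightarrow> nat list \<Rightarrow> nat" where
  "score g \<pi> = card {t\<in>{1..length \<pi>}. g t (feedback g \<pi> (t - 1)) = \<pi> ! (t - 1)}"

definition expected_score :: "nat \<Rightarrow> nat \<Rightarrow> (nat \<Rightarrow> bool list \<Rightarrow> nat) \<Rightarrow> real" where
  "expected_score m n g =
    measure_pmf.expectation (pmf_of_set (decks m n)) (\<lambda>\<pi>. real (score g \<pi>))"

text \<open>The following facts ensure that \<open>pmf_of_set\<close> on decks and \<open>Max\<close>, \<open>Min\<close> over strategies are
  meaningful.\<close>

lemma finite_decks: "finite (decks m n)"
  by (rule finite_subset[OF _ finite_lists_length_eq[of "{1..n}" "m * n"]])
    (auto simp: decks_def)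

lemma decks_nonempty: "decks m n \<noteq> {}"
proof -
  have "count_list (concat (map (replicate m) [1..<Suc n])) i = (if i \<in> {1..n} then m else 0)" for i
    by (induction n) (auto simp: count_list_eq_length_filter)
  moreover have "length (concat (map (replicate m) [1..<Suc n])) = m * n"
    by (induction n) auto
  moreover have "set (concat (map (replicate m) [1..<Suc n])) \<subseteq> {1..n}"
    by auto
  ultimately have "concat (map (replicate m) [1..<Suc n]) \<in> decks m n"
    by (simp add: decks_def del: upt_Suc)
  then show ?thesis by blast
qed

lemma finite_strategies: "finite (strategies m n)"
proof -
  have "finite {xs :: bool list. length xs = k}" for k
    using finite_lists_length_eq[of "UNIV :: bool set" k] by simp
  then show ?thesis
    unfolding strategies_def by (intro finite_PiE) auto
qed

lemma strategies_nonempty: "n \<ge> 1 \<Longrightarrow> strategies m n \<noteq> {}"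
  by (simp add: strategies_def PiE_eq_empty_iff)

end

theory Submission
  imports Defs "HOL-Combinatorics.Permutations"
begin

text \<open>Guess type \<open>1\<close> during the first \<open>T\<close> rounds, where \<open>T\<close> is half the size of the deck, and let
  \<open>X\<close> be the number of hits so far. Going on with type \<open>1\<close> gives the score \<open>m\<close> for certain; switching
  to type \<open>2\<close> changes the conditional expectation by \<open>n / (n - 1) * (X - T / n)\<close>. So one switches iff
  \<open>X > T / n\<close> (for the misere game, iff \<open>X < T / n\<close>), and as \<open>T / n\<close> is the mean of \<open>X\<close>, the gain
  (or loss) is \<open>n / (n - 1)\<close> times half the mean absolute deviation of \<open>X\<close>.

  For the lower bound on this deviation, compare \<open>X\<close> with the number \<open>X'\<close> of cards of type \<open>1\<close> among
  the last \<open>T\<close>, which has the same distribution. Swapping the cards at the mirror positions \<open>i\<close> and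
  \<open>m n - 1 - i\<close> makes \<open>X - X'\<close> a sum of symmetric signs, so its second moment is close to \<open>m\<close> and its
  fourth moment at most \<open>3 m\<^sup>2\<close>, which forces \<open>E \<bar>X - X'\<bar>\<close> to be of order \<open>sqrt m\<close>.\<close>

hide_const (open) Finite_Cartesian_Product.transpose

section \<open>Sums that are symmetric under sign flips\<close>

lemma sum_odd_under_bij:
  fixes f :: "'a \<Rightarrow> real"
  assumes "bij_betw \<sigma> \<Omega> \<Omega>" and "\<And>x. x \<in> \<Omega> \<Longrightarrow> f (\<sigma> x) = - f x"
  shows "sum f \<Omega> = 0"
proof -
  have "sum f \<Omega> = (\<Sum>x\<in>\<Omega>. f (\<sigma> x))"
    using sum.reindex_bij_betw[OF assms(1), of f] by simp
  also have "\<dots> = - sum f \<Omega>"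
    using assms(2) by (simp add: sum_negf)
  finally show ?thesis by simp
qed

text \<open>Expanding the square one summand at a time, each mixed term is odd under the flip
  \<open>\<sigma> k\<close> and sums to zero. The invariant weight \<open>W\<close> is carried along
  for the fourth moment, where it is the square of the summand just added.\<close>

lemma sum_sign_flip_second_moment:
  fixes d :: "nat \<Rightarrow> 'a \<Rightarrow> real"
  assumes bij: "\<And>i. i < k \<Longrightarrow> bij_betw (\<sigma> i) \<Omega> \<Omega>"
    and neg: "\<And>i x. i < k \<Longrightarrow> x \<in> \<Omega> \<Longrightarrow> d i (\<sigma> i x) = - d i x"
    and inv: "\<And>i j x. i < k \<Longrightarrow> j < k \<Longrightarrow> j \<noteq> i \<Longrightarrow> x \<in> \<Omega> \<Longrightarrow> d j (\<sigma> i x) = d j x"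
    and W: "\<And>i x. i < k \<Longrightarrow> x \<in> \<Omega> \<Longrightarrow> W (\<sigma> i x) = W x"
  shows "(\<Sum>x\<in>\<Omega>. (\<Sum>i<k. d i x)\<^sup>2 * W x) = (\<Sum>x\<in>\<Omega>. (\<Sum>i<k. (d i x)\<^sup>2) * W x)"
  using assms
proof (induction k)
  case 0
  then show ?case by simp
next
  case (Suc k)
  have IH: "(\<Sum>x\<in>\<Omega>. (\<Sum>i<k. d i x)\<^sup>2 * W x) = (\<Sum>x\<in>\<Omega>. (\<Sum>i<k. (d i x)\<^sup>2) * W x)"
    by (rule Suc.IH) (use Suc.prems in auto)
  have zero: "(\<Sum>x\<in>\<Omega>. 2 * (\<Sum>i<k. d i x) * d k x * W x) = 0"
    by (rule sum_odd_under_bij[of "\<sigma> k"]) (use Suc.prems in auto)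
  have "(\<Sum>x\<in>\<Omega>. (\<Sum>i<Suc k. d i x)\<^sup>2 * W x) =
      (\<Sum>x\<in>\<Omega>. (\<Sum>i<k. d i x)\<^sup>2 * W x) + (\<Sum>x\<in>\<Omega>. 2 * (\<Sum>i<k. d i x) * d k x * W x)
      + (\<Sum>x\<in>\<Omega>. (d k x)\<^sup>2 * W x)"
    by (simp add: power2_eq_square algebra_simps sum.distrib[symmetric])
  then show ?case
    unfolding zero IH by (simp add: algebra_simps sum.distrib)
qed

text \<open>A Khintchine inequality with its constant 3: the flips make the summands behave like
  independent symmetric signs. In the induction the terms odd in \<open>d k\<close> vanish, and the
  weighted second moment turns the term with coefficient 6 into the mixed term of a completed
  square.\<close>

lemma sum_sign_flip_fourth_moment:
  fixes d :: "nat \<Rightarrow> 'a \<Rightarrow> real"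
  assumes bij: "\<And>i. i < k \<Longrightarrow> bij_betw (\<sigma> i) \<Omega> \<Omega>"
    and neg: "\<And>i x. i < k \<Longrightarrow> x \<in> \<Omega> \<Longrightarrow> d i (\<sigma> i x) = - d i x"
    and inv: "\<And>i j x. i < k \<Longrightarrow> j < k \<Longrightarrow> j \<noteq> i \<Longrightarrow> x \<in> \<Omega> \<Longrightarrow> d j (\<sigma> i x) = d j x"
  shows "(\<Sum>x\<in>\<Omega>. (\<Sum>i<k. d i x) ^ 4) \<le> 3 * (\<Sum>x\<in>\<Omega>. (\<Sum>i<k. (d i x)\<^sup>2)\<^sup>2)"
  using assms
proof (induction k)
  case 0
  then show ?case by simp
next
  case (Suc k)
  define Y where "Y x = (\<Sum>i<k. d i x)" for x
  define D where "D x = (\<Sum>i<k. (d i x)\<^sup>2)" for x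
  have IH: "(\<Sum>x\<in>\<Omega>. Y x ^ 4) \<le> 3 * (\<Sum>x\<in>\<Omega>. (D x)\<^sup>2)"
    unfolding Y_def D_def by (rule Suc.IH) (use Suc.prems in auto)
  have Y: "Y (\<sigma> k x) = Y x" if "x \<in> \<Omega>" for x
    unfolding Y_def using Suc.prems that by (intro sum.cong) auto
  have zero: "(\<Sum>x\<in>\<Omega>. 4 * Y x ^ 3 * d k x + 4 * Y x * d k x ^ 3) = 0"
    by (rule sum_odd_under_bij[of "\<sigma> k"]) (use Suc.prems Y in auto)
  have second: "(\<Sum>x\<in>\<Omega>. (Y x)\<^sup>2 * (d k x)\<^sup>2) = (\<Sum>x\<in>\<Omega>. D x * (d k x)\<^sup>2)"
    unfolding Y_def D_def
    by (rule sum_sign_flip_second_moment[of _ \<sigma>]) (use Suc.prems in auto)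
  have "(\<Sum>x\<in>\<Omega>. (\<Sum>i<Suc k. d i x) ^ 4) =
      (\<Sum>x\<in>\<Omega>. Y x ^ 4 + (4 * Y x ^ 3 * d k x + 4 * Y x * d k x ^ 3)
        + 6 * ((Y x)\<^sup>2 * (d k x)\<^sup>2) + d k x ^ 4)"
    by (intro sum.cong) (simp_all add: Y_def[symmetric] power4_eq_xxxx power3_eq_cube power2_eq_square algebra_simps)
  also have "\<dots> = (\<Sum>x\<in>\<Omega>. Y x ^ 4) + 6 * (\<Sum>x\<in>\<Omega>. D x * (d k x)\<^sup>2) + (\<Sum>x\<in>\<Omega>. d k x ^ 4)"
    unfolding sum.distrib[of _ _ \<Omega>] using zero second
    by (simp add: sum_distrib_left[symmetric] sum.distrib)
  \<comment> \<open>Besides the induction hypothesis, the coefficient of \<open>d k x ^ 4\<close> is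
    raised from 1 to 3 to complete the square.\<close>
  also have "\<dots> \<le> 3 * (\<Sum>x\<in>\<Omega>. (D x)\<^sup>2) + 6 * (\<Sum>x\<in>\<Omega>. D x * (d k x)\<^sup>2) + 3 * (\<Sum>x\<in>\<Omega>. d k x ^ 4)"
    using IH sum_nonneg[of \<Omega> "\<lambda>x. d k x ^ 4"] by simp
  also have "\<dots> = 3 * (\<Sum>x\<in>\<Omega>. (D x + (d k x)\<^sup>2)\<^sup>2)"
    by (simp add: sum_distrib_left sum.distrib[symmetric] power4_eq_xxxx power2_eq_square algebra_simps)
  finally show ?case by (simp add: D_def)
qed

text \<open>The constants make the bound tight to second order at \<open>\<bar>y\<bar> = c\<close>: with \<open>u = \<bar>y\<bar> / c\<close> it
  amounts to \<open>0 \<le> u (u - 1)\<^sup>2 (u + 2)\<close>.\<close>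

lemma abs_ge_quartic:
  fixes y c :: real
  assumes "c > 0"
  shows "\<bar>y\<bar> \<ge> (3 * y\<^sup>2 / c - y ^ 4 / c ^ 3) / 2"
proof -
  define u where "u = \<bar>y\<bar> / c"
  have u: "u \<ge> 0" "\<bar>y\<bar> = c * u" using assms by (auto simp: u_def)
  have "0 \<le> u * ((u - 1)\<^sup>2 * (u + 2))" using u by simp
  then have "(3 * u\<^sup>2 - u ^ 4) / 2 \<le> u"
    by (simp add: power2_eq_square power4_eq_xxxx algebra_simps)
  then have "c * ((3 * u\<^sup>2 - u ^ 4) / 2) \<le> c * u"
    using assms by (intro mult_left_mono) auto
  moreover have "y\<^sup>2 = c\<^sup>2 * u\<^sup>2" 
    using u(2) by (metis power2_abs power_mult_distrib)
  moreover have "y ^ 4 = c ^ 4 * u ^ 4"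
    using u(2) by (metis power_even_abs_numeral even_numeral power_mult_distrib)
  ultimately show ?thesis using assms u(2)
    by (simp add: field_simps power2_eq_square power4_eq_xxxx power3_eq_cube)
qed

section \<open>Symmetries of the set of decks\<close>

lemma bij_betw_involution:
  assumes "\<And>x. x \<in> A \<Longrightarrow> f x \<in> A" and "\<And>x. x \<in> A \<Longrightarrow> f (f x) = x"
  shows "bij_betw f A A"
  using assms by (intro bij_betw_byWitness[of _ f]) auto

lemma length_deck: "\<pi> \<in> decks m n \<Longrightarrow> length \<pi> = m * n"
  by (simp add: decks_def)

lemma mset_eq_decks_iff:
  assumes "mset \<pi> = mset \<pi>'"
  shows "\<pi> \<in> decks m n \<longleftrightarrow> \<pi>' \<in> decks m n"
proof -
  have "count_list \<pi> i = count_list \<pi>' i" for i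
    using assms by (metis count_mset)
  then show ?thesis
    using mset_eq_length[OF assms] mset_eq_setD[OF assms] by (simp add: decks_def)
qed

lemma bij_betw_rev_decks: "bij_betw rev (decks m n) (decks m n)"
  by (rule bij_betw_involution) (simp_all add: mset_eq_decks_iff[OF mset_rev])

lemma bij_betw_swap_positions_decks:
  assumes "i < m * n" "j < m * n"
  shows "bij_betw (permute_list (transpose i j)) (decks m n) (decks m n)"
proof (rule bij_betw_involution)
  have p: "transpose i j permutes {..<m * n}"
    using assms by (intro permutes_swap_id) auto
  fix \<pi> assume \<pi>: "\<pi> \<in> decks m n"
  note len = length_deck[OF \<pi>]
  show "permute_list (transpose i j) \<pi> \<in> decks m n"
    using mset_permute_list[of "transpose i j" \<pi>] p len \<pi> mset_eq_decks_iff by metis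
  show "permute_list (transpose i j) (permute_list (transpose i j) \<pi>) = \<pi>"
    using permute_list_compose[of "transpose i j" \<pi> "transpose i j"] p len
    by simp
qed

lemma nth_swap_positions_deck:
  assumes "\<pi> \<in> decks m n" "i < m * n" "j < m * n" "k < m * n"
  shows "permute_list (transpose i j) \<pi> ! k = \<pi> ! transpose i j k"
  using assms by (intro permute_list_nth) (auto simp: length_deck intro: permutes_swap_id)

lemma count_list_map_transpose:
  "count_list (map (transpose a b) xs) c = count_list xs (transpose a b c)"
  by (induction xs) (auto simp: Transposition.transpose_def)

lemma bij_betw_swap_types_decks:
  assumes "a \<in> {1..n}" "b \<in> {1..n}"
  shows "bij_betw (map (transpose a b)) (decks m n) (decks m n)"
proof (rule bij_betw_involution)
  have t: "transpose a b c \<in> {1..n}" if "c \<in> {1..n}" for c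
    using assms that by (auto simp: Transposition.transpose_def)
  fix \<pi> assume \<pi>: "\<pi> \<in> decks m n"
  show "map (transpose a b) \<pi> \<in> decks m n"
    using \<pi> t by (auto simp: decks_def count_list_map_transpose)
  show "map (transpose a b) (map (transpose a b) \<pi>) = \<pi>"
    by (simp add: comp_def)
qed

section \<open>Card types at given positions of a random deck\<close>

text \<open>Real-valued, so that counts are sums and joint events products. Position
  \<open>i\<close> holds the card seen at time \<open>i + 1\<close>.\<close>

definition hit :: "nat list \<Rightarrow> nat \<Rightarrow> nat \<Rightarrow> real" where
  "hit \<pi> c i = of_bool (\<pi> ! i = c)"

lemma hit_nonneg: "hit \<pi> c i \<ge> 0"
  and hit_idem: "hit \<pi> c i * hit \<pi> c i = hit \<pi> c i"
  by (simp_all add: hit_def)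

lemma sum_hit_take: "T \<le> length \<pi> \<Longrightarrow> (\<Sum>i<T. hit \<pi> c i) = real (count_list (take T \<pi>) c)"
proof (induction T)
  case (Suc T)
  then show ?case by (simp add: take_Suc_conv_app_nth hit_def)
qed simp

lemma sum_hit_positions:
  assumes "\<pi> \<in> decks m n" "c \<in> {1..n}"
  shows "(\<Sum>i<m * n. hit \<pi> c i) = real m"
  using assms sum_hit_take[of "m * n" \<pi> c] by (simp add: decks_def)

lemma sum_hit_types:
  assumes "\<pi> \<in> decks m n" "i < m * n"
  shows "(\<Sum>c\<in>{1..n}. hit \<pi> c i) = 1"
proof -
  have "\<pi> ! i \<in> {1..n}"
    using assms nth_mem[of i \<pi>] by (auto simp: decks_def simp del: nth_mem)
  then show ?thesis by (simp add: hit_def of_bool_def)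
qed

lemma hit_swap_types:
  assumes "\<pi> \<in> decks m n" "i < m * n"
  shows "hit (map (transpose a b) \<pi>) c i = hit \<pi> (transpose a b c) i"
  using assms by (auto simp: hit_def length_deck Transposition.transpose_def)

text \<open>Exchanging two types permutes the decks, so all \<open>n\<close> types are equally
  frequent at position \<open>i\<close>, and each deck has exactly one type there.\<close>

lemma sum_decks_hit:
  assumes "c \<in> {1..n}" "i < m * n"
  shows "(\<Sum>\<pi>\<in>decks m n. hit \<pi> c i) = real (card (decks m n)) / real n"
proof -
  have eq: "(\<Sum>\<pi>\<in>decks m n. hit \<pi> b i) = (\<Sum>\<pi>\<in>decks m n. hit \<pi> c i)" if "b \<in> {1..n}" for b
    using sum.reindex_bij_betw[OF bij_betw_swap_types_decks[OF that assms(1)], of "\<lambda>\<pi>. hit \<pi> b i" m]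
      assms by (simp add: hit_swap_types cong: sum.cong)
  have "real n * (\<Sum>\<pi>\<in>decks m n. hit \<pi> c i) = (\<Sum>b\<in>{1..n}. \<Sum>\<pi>\<in>decks m n. hit \<pi> b i)"
    by (simp add: eq)
  also have "\<dots> = (\<Sum>\<pi>\<in>decks m n. \<Sum>b\<in>{1..n}. hit \<pi> b i)"
    by (rule sum.swap)
  also have "\<dots> = (\<Sum>\<pi>\<in>decks m n. 1)"
    using assms by (intro sum.cong sum_hit_types) auto
  finally show ?thesis using assms by (simp add: field_simps)
qed

text \<open>Swapping positions \<open>j\<close> and \<open>k\<close> fixes \<open>i\<close>, so the
  sum is the same for every second position. Adding over all of them counts, in each deck with type
  \<open>c\<close> at \<open>i\<close>, the other \<open>m - 1\<close> copies of
  \<open>c\<close>.\<close>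

lemma sum_decks_hit_pair:
  assumes "c \<in> {1..n}" "i < m * n" "j < m * n" "i \<noteq> j"
  shows "(\<Sum>\<pi>\<in>decks m n. hit \<pi> c i * hit \<pi> c j) =
    real (card (decks m n)) * (real m - 1) / (real n * (real (m * n) - 1))"
proof -
  let ?S = "\<lambda>k. \<Sum>\<pi>\<in>decks m n. hit \<pi> c i * hit \<pi> c k"
  have eq: "?S k = ?S j" if "k \<in> {..<m * n} - {i}" for k
    using sum.reindex_bij_betw[OF bij_betw_swap_positions_decks[of j m n k],
        of "\<lambda>\<pi>. hit \<pi> c i * hit \<pi> c k"] that assms
    by (simp add: hit_def nth_swap_positions_deck transpose_apply_other cong: sum.cong)
  have "(\<Sum>k\<in>{..<m * n} - {i}. ?S k) = (\<Sum>k\<in>{..<m * n} - {i}. ?S j)"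
    by (rule sum.cong[OF refl eq])
  moreover have "real (m * n - 1) = real (m * n) - 1"
    using assms(2) by (intro of_nat_diff[of 1, simplified of_nat_1]) linarith
  ultimately have "(real (m * n) - 1) * ?S j = (\<Sum>k\<in>{..<m * n} - {i}. ?S k)"
    using assms(2) by (simp add: card_Diff_singleton)
  also have "\<dots> = (\<Sum>\<pi>\<in>decks m n. \<Sum>k\<in>{..<m * n} - {i}. hit \<pi> c i * hit \<pi> c k)"
    by (rule sum.swap)
  also have "\<dots> = (\<Sum>\<pi>\<in>decks m n. (real m - 1) * hit \<pi> c i)"
  proof (rule sum.cong)
    fix \<pi> assume \<pi>: "\<pi> \<in> decks m n"
    have "(\<Sum>k\<in>{..<m * n} - {i}. hit \<pi> c i * hit \<pi> c k) = hit \<pi> c i * (real m - hit \<pi> c i)"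
      using sum_hit_positions[OF \<pi> assms(1)] assms(2)
      by (simp add: sum_distrib_left[symmetric] sum_diff1)
    then show "(\<Sum>k\<in>{..<m * n} - {i}. hit \<pi> c i * hit \<pi> c k) = (real m - 1) * hit \<pi> c i"
      using hit_idem[of \<pi> c i] by (simp add: algebra_simps)
  qed simp
  also have "\<dots> = (real m - 1) * (real (card (decks m n)) / real n)"
    using assms by (simp add: sum_decks_hit sum_distrib_left[symmetric])
  finally have *: "(real (m * n) - 1) * ?S j = (real m - 1) * (real (card (decks m n)) / real n)" .
  \<comment> \<open>Two distinct positions exist, so the divisor is nonzero.\<close>
  have "m * n > 1" using assms by linarith
  then have "real (m * n) - 1 \<noteq> 0" by linarith
  with * have "?S j = (real m - 1) * (real (card (decks m n)) / real n) / (real (m * n) - 1)"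
    by (metis nonzero_mult_div_cancel_left)
  then show ?thesis by (simp add: mult.commute)
qed

section \<open>Deviation of the number of hits in the first half\<close>

lemma sum_decks_abs_deviation:
  fixes m n :: nat
  assumes "m \<ge> 1" "n \<ge> 8"
  defines "T \<equiv> m * n div 2"
  shows "(\<Sum>\<pi>\<in>decks m n. \<bar>(\<Sum>i<T. hit \<pi> 1 i) - real T / real n\<bar>)
    \<ge> real (card (decks m n)) * (15 / 64 * sqrt (real m))"
proof -
  define N K where "N = m * n" and "K = real (card (decks m n))"
  define X where "X \<pi> = (\<Sum>i<T. hit \<pi> 1 i)" for \<pi>
  define d where "d i \<pi> = hit \<pi> 1 i - hit \<pi> 1 (N - 1 - i)" for i \<pi>
  define Y where "Y \<pi> = (\<Sum>i<T. d i \<pi>)" for \<pi>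
  define D where "D \<pi> = (\<Sum>i<T. (d i \<pi>)\<^sup>2)" for \<pi>
  define \<sigma> where "\<sigma> i = (permute_list (transpose i (N - 1 - i)) :: nat list \<Rightarrow> nat list)" for i
  have N8: "N \<ge> 8" unfolding N_def using assms by (metis mult_le_mono nat_mult_1)
  \<comment> \<open>For odd \<open>N\<close> the middle position is its own mirror image and belongs
    to neither half.\<close>
  have T: "2 * T \<le> N" "2 * T + 1 \<ge> N" unfolding T_def N_def by auto
  have K: "K \<ge> 0" by (simp add: K_def)
  have Y_X: "Y \<pi> = X \<pi> - X (rev \<pi>)" if "\<pi> \<in> decks m n" for \<pi>
    unfolding Y_def X_def d_def sum_subtractf
    using T that N8 by (auto simp: hit_def rev_nth length_deck N_def intro!: sum.cong)

  have flip: "bij_betw (\<sigma> i) (decks m n) (decks m n)" if "i < T" for i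
    unfolding \<sigma>_def using that T N8 by (intro bij_betw_swap_positions_decks) (auto simp: N_def)
  have d_flip: "d j (\<sigma> i \<pi>) = (if j = i then - d j \<pi> else d j \<pi>)"
    if "i < T" "j < T" "\<pi> \<in> decks m n" for i j \<pi>
  proof -
    have "i < m * n" "N - 1 - i < m * n" "j < m * n" "N - 1 - j < m * n"
      using that T N8 by (auto simp: N_def)
    \<comment> \<open>The mirror pairs are disjoint, so swapping one pair negates its own difference
      and leaves the others alone.\<close>
    moreover have "i \<noteq> N - 1 - j" "N - 1 - i \<noteq> j" "j \<noteq> i \<Longrightarrow> N - 1 - j \<noteq> N - 1 - i"
      using that T N8 by auto
    ultimately show ?thesis
      using that by (auto simp: d_def \<sigma>_def hit_def nth_swap_positions_deck Transposition.transpose_def)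
  qed
  \<comment> \<open>For indicators the squared difference is at most the sum, and disjoint pairs
    together contain at most \<open>m\<close> cards of type 1.\<close>
  have D_le: "D \<pi> \<le> real m" if "\<pi> \<in> decks m n" for \<pi>
  proof -
    have "D \<pi> \<le> (\<Sum>i<T. hit \<pi> 1 i + hit \<pi> 1 (N - 1 - i))"
      unfolding D_def by (intro sum_mono) (auto simp: d_def hit_def)
    also have "\<dots> = (\<Sum>i<T. hit \<pi> 1 i) + (\<Sum>i\<in>(\<lambda>i. N - 1 - i) ` {..<T}. hit \<pi> 1 i)"
    proof -
      have "inj_on (\<lambda>i. N - 1 - i) {..<T}" using T N8 by (auto simp: inj_on_def)
      then show ?thesis by (simp add: sum.distrib sum.reindex)
    qed
    also have "\<dots> = (\<Sum>i\<in>{..<T} \<union> (\<lambda>i. N - 1 - i) ` {..<T}. hit \<pi> 1 i)"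
      using T N8 by (intro sum.union_disjoint[symmetric]) auto
    also have "\<dots> \<le> (\<Sum>i<m * n. hit \<pi> 1 i)"
      using T N8 by (intro sum_mono2) (auto simp: N_def hit_nonneg)
    finally show ?thesis using sum_hit_positions[OF that, of 1] assms by simp
  qed
  have D_nonneg: "D \<pi> \<ge> 0" for \<pi> unfolding D_def by (intro sum_nonneg) auto

  have sum_d: "(\<Sum>\<pi>\<in>decks m n. (d i \<pi>)\<^sup>2) = 2 * K / n * ((real N - m) / (real N - 1))" if "i < T" for i
  proof -
    have ij: "i < m * n" "N - 1 - i < m * n" "i \<noteq> N - 1 - i"
      using that T N8 by (auto simp: N_def)
    have one: "1 \<in> {1..n}" using assms by simp
    have "(\<Sum>\<pi>\<in>decks m n. (d i \<pi>)\<^sup>2) =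
      (\<Sum>\<pi>\<in>decks m n. hit \<pi> 1 i + hit \<pi> 1 (N - 1 - i) - 2 * (hit \<pi> 1 i * hit \<pi> 1 (N - 1 - i)))"
      by (intro sum.cong) (auto simp: d_def hit_def)
    also have "\<dots> = K / n + K / n - 2 * (K * (real m - 1) / (real n * (real N - 1)))"
      using sum_decks_hit_pair[OF one ij] sum_decks_hit[OF one ij(1)] sum_decks_hit[OF one ij(2)]
      by (simp add: sum.distrib sum_subtractf sum_distrib_left[symmetric] K_def N_def)
    also have "\<dots> = 2 * K / n * ((real N - m) / (real N - 1))"
      using N8 assms by (simp add: divide_simps) (simp add: algebra_simps)
    finally show ?thesis .
  qed
  have ED: "(\<Sum>\<pi>\<in>decks m n. D \<pi>) \<ge> K * (7 / 8 * m)"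
  proof -
    have "(\<Sum>\<pi>\<in>decks m n. D \<pi>) = (\<Sum>i<T. \<Sum>\<pi>\<in>decks m n. (d i \<pi>)\<^sup>2)"
      unfolding D_def by (rule sum.swap)
    also have "\<dots> = (2 * real T) * (K / n * ((real N - m) / (real N - 1)))"
      by (simp add: sum_d)
    \<comment> \<open>The bound \<open>2 * T \<ge> N - 1\<close> covers both parities and cancels
      the denominator exactly; then \<open>n \<ge> 8\<close> yields the factor 7/8.\<close>
    also have "\<dots> \<ge> (real N - 1) * (K / n * ((real N - m) / (real N - 1)))"
    proof (intro mult_right_mono mult_nonneg_nonneg divide_nonneg_nonneg)
      have "real (2 * T + 1) \<ge> real N" using T(2) by (rule of_nat_mono)
      then show "real N - 1 \<le> 2 * real T" by simp
      show "0 \<le> real N - real m" using assms by (simp add: N_def)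
    qed (use K N8 in auto)
    also have "(real N - 1) * (K / n * ((real N - m) / (real N - 1))) = K * (m - m / n)"
    proof -
      have "(real N - 1) * (K / n * ((real N - m) / (real N - 1))) = K / n * (real N - m)"
        using N8 by simp
      also have "\<dots> = K * (m - m / n)"
        using assms by (simp add: N_def field_simps)
      finally show ?thesis .
    qed
    also have "\<dots> \<ge> K * (7 / 8 * m)"
      using assms K by (intro mult_left_mono) (auto simp: field_simps)
    finally show ?thesis by simp
  qed
  have EY2: "(\<Sum>\<pi>\<in>decks m n. (Y \<pi>)\<^sup>2) = (\<Sum>\<pi>\<in>decks m n. D \<pi>)"
    using sum_sign_flip_second_moment[of T \<sigma> "decks m n" d "\<lambda>_. 1"] flip d_flip
    unfolding Y_def D_def by simp
  have EY4: "(\<Sum>\<pi>\<in>decks m n. Y \<pi> ^ 4) \<le> K * (3 * m\<^sup>2)"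
  proof -
    have "(\<Sum>\<pi>\<in>decks m n. Y \<pi> ^ 4) \<le> 3 * (\<Sum>\<pi>\<in>decks m n. (D \<pi>)\<^sup>2)"
      unfolding Y_def D_def by (rule sum_sign_flip_fourth_moment[of _ \<sigma>]) (use flip d_flip in auto)
    also have "(\<Sum>\<pi>\<in>decks m n. (D \<pi>)\<^sup>2) \<le> (\<Sum>\<pi>\<in>decks m n. (real m)\<^sup>2)"
      by (intro sum_mono power_mono D_le D_nonneg)
    finally show ?thesis by (simp add: K_def)
  qed
  define s where "s = sqrt (real m)"
  have s: "s > 0" "real m = s\<^sup>2" using assms by (auto simp: s_def)
  \<comment> \<open>The quartic bound is applied with \<open>c = 2 * s\<close>, close to the optimal
    \<open>sqrt (24 / 7) * s\<close>. The mean square is at least \<open>7 / 8 * m\<close> and the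
    mean fourth power at most \<open>3 * m^2\<close>, which gives (21/16 - 3/8) / 2 = 15/32.\<close>
  have "K * (15 / 32 * s) = (3 / (2 * s) * (K * (7 / 8 * m)) - 1 / (2 * s) ^ 3 * (K * (3 * m\<^sup>2))) / 2"
    using s by (simp add: field_simps power2_eq_square power3_eq_cube)
  also have "\<dots> \<le> (3 / (2 * s) * (\<Sum>\<pi>\<in>decks m n. (Y \<pi>)\<^sup>2) - 1 / (2 * s) ^ 3 * (\<Sum>\<pi>\<in>decks m n. Y \<pi> ^ 4)) / 2"
    using ED EY4 s unfolding EY2[symmetric]
    by (intro divide_right_mono diff_mono mult_left_mono) auto
  also have "\<dots> = (\<Sum>\<pi>\<in>decks m n. (3 * (Y \<pi>)\<^sup>2 / (2 * s) - Y \<pi> ^ 4 / (2 * s) ^ 3) / 2)"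
    by (simp add: sum_distrib_left sum_divide_distrib[symmetric] sum_subtractf)
  also have "\<dots> \<le> (\<Sum>\<pi>\<in>decks m n. \<bar>Y \<pi>\<bar>)"
    using s by (intro sum_mono abs_ge_quartic) auto
  \<comment> \<open>Triangle inequality through the mean. Reversal permutes the decks, so both terms
    have equal sums, and 15/32 is halved to 15/64.\<close>
  also have "\<dots> \<le> (\<Sum>\<pi>\<in>decks m n. \<bar>X \<pi> - real T / n\<bar> + \<bar>X (rev \<pi>) - real T / n\<bar>)"
    using Y_X by (intro sum_mono) force
  also have "\<dots> = 2 * (\<Sum>\<pi>\<in>decks m n. \<bar>X \<pi> - real T / n\<bar>)"
    using sum.reindex_bij_betw[OF bij_betw_rev_decks, of "\<lambda>\<pi>. \<bar>X \<pi> - real T / n\<bar>" m n]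
    by (simp add: sum.distrib)
  finally show ?thesis unfolding X_def K_def s_def by simp
qed

section \<open>The switching strategy\<close>

text \<open>The restricted abstractions put it into the extensional function space
  \<open>strategies\<close>. Since every guess up to time \<open>T\<close> is 1, the first
  \<open>T\<close> feedback bits show exactly the positions of type 1. The predicate
  \<open>P\<close> on their count serves both games.\<close>

definition switch_strategy :: "nat \<Rightarrow> nat \<Rightarrow> nat \<Rightarrow> (nat \<Rightarrow> bool) \<Rightarrow> nat \<Rightarrow> bool list \<Rightarrow> nat" where
  "switch_strategy m n T P = (\<lambda>t\<in>{1..m * n}. \<lambda>xs\<in>{xs. length xs = t - 1}.
     if T < t \<and> P (count_list (take T xs) True) then 2 else 1)"

lemma switch_strategy_in_strategies: "n \<ge> 2 \<Longrightarrow> switch_strategy m n T P \<in> strategies m n"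
  unfolding strategies_def switch_strategy_def by auto

lemma length_feedback: "length (feedback g \<pi> t) = t"
  by (induction t) auto

lemma take_feedback: "s \<le> t \<Longrightarrow> take s (feedback g \<pi> t) = feedback g \<pi> s"
proof (induction t)
  case (Suc t)
  then show ?case by (cases "s = Suc t") (simp_all add: length_feedback)
qed simp

lemma feedback_switch_strategy:
  assumes "length \<pi> = m * n" "T \<le> m * n" "t \<le> T"
  shows "feedback (switch_strategy m n T P) \<pi> t = map (\<lambda>c. c = 1) (take t \<pi>)"
  using assms(3)
proof (induction t)
  case (Suc t)
  then show ?case using assms
    by (auto simp: switch_strategy_def take_Suc_conv_app_nth)
qed simp

lemma switch_strategy_guess:
  assumes "length \<pi> = m * n" "T \<le> m * n" "t < m * n"
  shows "switch_strategy m n T P (Suc t) (feedback (switch_strategy m n T P) \<pi> t) =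
    (if T \<le> t \<and> P (count_list (take T \<pi>) 1) then 2 else 1)"
proof -
  have "count_list (map (\<lambda>c. c = 1) xs) True = count_list xs (1 :: nat)" for xs
    by (induction xs) auto
  then have "T \<le> t \<Longrightarrow> count_list (take T (feedback (switch_strategy m n T P) \<pi> t)) True
      = count_list (take T \<pi>) 1"
    using assms by (simp add: take_feedback feedback_switch_strategy)
  \<comment> \<open>At time \<open>Suc t\<close> the test \<open>T < Suc t\<close> reads
    \<open>T \<le> t\<close> in terms of the position \<open>t\<close>.\<close>
  then show ?thesis using assms(3)
    unfolding switch_strategy_def by (auto simp: length_feedback less_Suc_eq_le)
qed

text \<open>Staying with type 1 collects all \<open>m\<close> of its copies. Switching gives up
  those not yet seen in exchange for the remaining cards of type 2.\<close>

lemma score_switch_strategy: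
  assumes \<pi>: "\<pi> \<in> decks m n" and "T \<le> m * n" "n \<ge> 2"
  shows "real (score (switch_strategy m n T P) \<pi>) = real m + of_bool (P (count_list (take T \<pi>) 1)) *
    ((\<Sum>i<T. hit \<pi> 1 i) - real m + (\<Sum>i\<in>{T..<m * n}. hit \<pi> 2 i))"
proof -
  define g where "g = switch_strategy m n T P"
  define A where "A \<longleftrightarrow> P (count_list (take T \<pi>) 1)"
  have len: "length \<pi> = m * n" using \<pi> by (rule length_deck)
  \<comment> \<open>Passes from times, which start at 1, to list positions, which start at
    0.\<close>
  have "score g \<pi> = card (Suc ` {t\<in>{..<m * n}. g (Suc t) (feedback g \<pi> t) = \<pi> ! t})"
    unfolding score_def len
  proof (rule arg_cong[of _ _ card], safe)
    fix t assume t: "t \<in> {1..m * n}" "g t (feedback g \<pi> (t - 1)) = \<pi> ! (t - 1)"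
    then obtain u where "t = Suc u" by (cases t) auto
    then show "t \<in> Suc ` {t\<in>{..<m * n}. g (Suc t) (feedback g \<pi> t) = \<pi> ! t}" using t by auto
  qed auto
  also have "\<dots> = card {t\<in>{..<m * n}. g (Suc t) (feedback g \<pi> t) = \<pi> ! t}"
    by (simp add: card_image)
  also have "real \<dots> = (\<Sum>t<m * n. of_bool (g (Suc t) (feedback g \<pi> t) = \<pi> ! t))"
    by (simp add: Int_def)
  also have "\<dots> = (\<Sum>t<m * n. if T \<le> t \<and> A then hit \<pi> 2 t else hit \<pi> 1 t)"
    using len assms(2) by (intro sum.cong) (auto simp: g_def A_def switch_strategy_guess hit_def)
  also have "\<dots> = (\<Sum>t<T. hit \<pi> 1 t) + (\<Sum>t\<in>{T..<m * n}. if A then hit \<pi> 2 t else hit \<pi> 1 t)"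
  proof -
    have "{..<m * n} = {..<T} \<union> {T..<m * n}" using assms(2) by auto
    then show ?thesis by (simp add: sum.union_disjoint ivl_disj_int)
  qed
  finally have eq: "real (score g \<pi>) =
    (\<Sum>t<T. hit \<pi> 1 t) + (\<Sum>t\<in>{T..<m * n}. if A then hit \<pi> 2 t else hit \<pi> 1 t)" .
  have "(\<Sum>t<T. hit \<pi> 1 t) + (\<Sum>t\<in>{T..<m * n}. hit \<pi> 1 t) = real m"
    using sum_hit_positions[OF \<pi>, of 1] assms sum.atLeastLessThan_concat[of 0 T "m * n" "hit \<pi> 1"]
    by (simp add: atLeast0LessThan)
  then show ?thesis
    using eq unfolding g_def[symmetric] A_def[symmetric] by (cases A) auto
qed

text \<open>On the event of switching, the types \<open>2, \<dots>, n\<close> are exchangeable, so type \<open>2\<close> gets the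
  fraction \<open>1 / (n - 1)\<close> of the remaining cards that are not of type \<open>1\<close>.\<close>

lemma sum_decks_score_switch_strategy:
  assumes "T \<le> m * n" "n \<ge> 2"
  shows "(\<Sum>\<pi>\<in>decks m n. real (score (switch_strategy m n T P) \<pi>)) = real (card (decks m n)) * real m +
    real n / (real n - 1) * (\<Sum>\<pi>\<in>decks m n. of_bool (P (count_list (take T \<pi>) 1)) *
      ((\<Sum>i<T. hit \<pi> 1 i) - real T / real n))"
proof -
  define p :: "nat list \<Rightarrow> real" where "p \<pi> = of_bool (P (count_list (take T \<pi>) 1))" for \<pi>
  define X where "X \<pi> = (\<Sum>i<T. hit \<pi> 1 i)" for \<pi>
  define C where "C c \<pi> = (\<Sum>i\<in>{T..<m * n}. hit \<pi> c i)" for c \<pi>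
  have C_eq: "(\<Sum>\<pi>\<in>decks m n. p \<pi> * C c \<pi>) = (\<Sum>\<pi>\<in>decks m n. p \<pi> * C 2 \<pi>)" if "c \<in> {2..n}" for c
  proof -
    \<comment> \<open>As \<open>c \<ge> 2\<close>, the exchange does not touch type 1, so the
      decision to switch is unchanged.\<close>
    have "transpose 2 c 1 = 1" using that by (auto simp: Transposition.transpose_def)
    then have "p (map (transpose 2 c) \<pi>) = p \<pi>" for \<pi>
      by (simp add: p_def take_map count_list_map_transpose)
    moreover have "C c (map (transpose 2 c) \<pi>) = C 2 \<pi>" if "\<pi> \<in> decks m n" for \<pi>
      unfolding C_def using that by (intro sum.cong) (auto simp: hit_swap_types)
    ultimately show ?thesis
      using sum.reindex_bij_betw[OF bij_betw_swap_types_decks[of 2 n c], of "\<lambda>\<pi>. p \<pi> * C c \<pi>" m] that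
      by (simp cong: sum.cong)
  qed
  \<comment> \<open>After \<open>T\<close> rounds \<open>m * n - T\<close> cards remain, and
    \<open>m - X \<pi>\<close> of them are of type 1.\<close>
  have C_sum: "(\<Sum>c\<in>{2..n}. C c \<pi>) = real (m * n) - T - (real m - X \<pi>)" if "\<pi> \<in> decks m n" for \<pi>
  proof -
    have "C 1 \<pi> + (\<Sum>c\<in>{2..n}. C c \<pi>) = (\<Sum>c\<in>{1..n}. C c \<pi>)"
      using assms by (subst sum.atLeast_Suc_atMost[of 1 n]) (auto simp: numeral_2_eq_2)
    also have "\<dots> = (\<Sum>i\<in>{T..<m * n}. \<Sum>c\<in>{1..n}. hit \<pi> c i)"
      unfolding C_def by (rule sum.swap)
    also have "\<dots> = (\<Sum>i\<in>{T..<m * n}. 1)"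
      using that by (intro sum.cong sum_hit_types) auto
    finally have "C 1 \<pi> + (\<Sum>c\<in>{2..n}. C c \<pi>) = real (m * n) - T"
      using assms(1) by (simp add: of_nat_diff)
    moreover have "X \<pi> + C 1 \<pi> = real m"
      using sum_hit_positions[OF that, of 1] assms sum.atLeastLessThan_concat[of 0 T "m * n" "hit \<pi> 1"]
      by (simp add: atLeast0LessThan X_def C_def)
    ultimately show ?thesis by simp
  qed
  have "(real n - 1) * (\<Sum>\<pi>\<in>decks m n. p \<pi> * C 2 \<pi>) = (\<Sum>c\<in>{2..n}. \<Sum>\<pi>\<in>decks m n. p \<pi> * C 2 \<pi>)"
    using assms by (simp add: of_nat_diff)
  also have "\<dots> = (\<Sum>c\<in>{2..n}. \<Sum>\<pi>\<in>decks m n. p \<pi> * C c \<pi>)"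
    by (intro sum.cong C_eq[symmetric] refl)
  also have "\<dots> = (\<Sum>\<pi>\<in>decks m n. \<Sum>c\<in>{2..n}. p \<pi> * C c \<pi>)"
    by (rule sum.swap)
  also have "\<dots> = (\<Sum>\<pi>\<in>decks m n. p \<pi> * (real (m * n) - T - (real m - X \<pi>)))"
    by (intro sum.cong) (simp_all add: sum_distrib_left[symmetric] C_sum)
  finally have C2: "(\<Sum>\<pi>\<in>decks m n. p \<pi> * C 2 \<pi>) =
      (\<Sum>\<pi>\<in>decks m n. p \<pi> * ((real (m * n) - T - (real m - X \<pi>)) / (real n - 1)))"
    using assms by (simp add: sum_divide_distrib[symmetric] field_simps)
  have "(\<Sum>\<pi>\<in>decks m n. real (score (switch_strategy m n T P) \<pi>)) =
      (\<Sum>\<pi>\<in>decks m n. real m + p \<pi> * (X \<pi> - real m) + p \<pi> * C 2 \<pi>)"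
    using assms by (intro sum.cong) (simp_all add: score_switch_strategy p_def X_def C_def algebra_simps)
  also have "\<dots> = real (card (decks m n)) * m + (\<Sum>\<pi>\<in>decks m n. p \<pi> * (X \<pi> - real m)
      + p \<pi> * ((real (m * n) - T - (real m - X \<pi>)) / (real n - 1)))"
    by (simp add: sum.distrib C2)
  also have "(\<Sum>\<pi>\<in>decks m n. p \<pi> * (X \<pi> - real m)
      + p \<pi> * ((real (m * n) - T - (real m - X \<pi>)) / (real n - 1))) =
      real n / (real n - 1) * (\<Sum>\<pi>\<in>decks m n. p \<pi> * (X \<pi> - T / n))"
    unfolding sum_distrib_left
  proof (intro sum.cong refl)
    fix \<pi>
    \<comment> \<open>Over the common denominator \<open>n - 1\<close> all terms in \<open>m\<close>
      cancel, which leaves the gain centred at \<open>T / n\<close>.\<close>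
    have "X \<pi> - real m + (real (m * n) - T - (real m - X \<pi>)) / (real n - 1)
        = real n / (real n - 1) * (X \<pi> - T / n)"
      using assms by (simp add: divide_simps) (simp add: algebra_simps)
    then show "p \<pi> * (X \<pi> - real m) + p \<pi> * ((real (m * n) - T - (real m - X \<pi>)) / (real n - 1)) =
        real n / (real n - 1) * (p \<pi> * (X \<pi> - T / n))"
      by (metis (no_types, lifting) distrib_left mult.left_commute)
  qed
  finally show ?thesis unfolding p_def X_def .
qed

lemma expected_score_eq_sum:
  "expected_score m n g = (\<Sum>\<pi>\<in>decks m n. real (score g \<pi>)) / real (card (decks m n))"
  unfolding expected_score_def
  by (rule integral_pmf_of_set) (use finite_decks decks_nonempty in auto)

theorem theorem1:
  fixes m n :: nat
  assumes "m \<ge> 1" and "n \<ge> 8 * m"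
  shows "Max (expected_score m n ` strategies m n) \<ge> real m + 1 / 40 * sqrt (real m) \<and>
         Min (expected_score m n ` strategies m n) \<le> real m - 1 / 40 * sqrt (real m)"
proof -
  have n8: "n \<ge> 8" using assms by linarith
  define T where "T = m * n div 2"
  define K where "K = real (card (decks m n))"
  define X where "X \<pi> = (\<Sum>i<T. hit \<pi> 1 i)" for \<pi>
  define \<mu> where "\<mu> = real T / real n"
  define q where "q = real n / (real n - 1)"
  have T: "T \<le> m * n" by (simp add: T_def)
  have K: "K > 0" using decks_nonempty finite_decks by (simp add: K_def card_gt_0_iff)
  have q: "q \<ge> 1" using n8 by (simp add: q_def)
  have X: "real (count_list (take T \<pi>) 1) = X \<pi>" if "\<pi> \<in> decks m n" for \<pi>
    using sum_hit_take[of T \<pi> 1] T that by (simp add: X_def length_deck)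
  have dev: "(\<Sum>\<pi>\<in>decks m n. \<bar>X \<pi> - \<mu>\<bar>) \<ge> K * (15 / 64 * sqrt m)"
    using sum_decks_abs_deviation[OF assms(1) n8] by (simp add: X_def \<mu>_def K_def T_def)
  have "(\<Sum>\<pi>\<in>decks m n. X \<pi>) = (\<Sum>i<T. \<Sum>\<pi>\<in>decks m n. hit \<pi> 1 i)"
    unfolding X_def by (rule sum.swap)
  also have "\<dots> = K * \<mu>"
    using T n8 by (simp add: sum_decks_hit \<mu>_def K_def)
  finally have mean: "(\<Sum>\<pi>\<in>decks m n. X \<pi> - \<mu>) = 0"
    by (simp add: sum_subtractf K_def)

  \<comment> \<open>The positive part and the negated negative part of \<open>X - \<mu>\<close>;
    ties contribute 0. Their sum vanishes because \<open>\<mu>\<close> is the mean, and their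
    difference is the absolute deviation, so each has half its size: 15/64 becomes 15/128.\<close>
  define up where "up = (\<Sum>\<pi>\<in>decks m n. of_bool (X \<pi> > \<mu>) * (X \<pi> - \<mu>))"
  define dn where "dn = (\<Sum>\<pi>\<in>decks m n. of_bool (X \<pi> < \<mu>) * (X \<pi> - \<mu>))"
  have "up + dn = (\<Sum>\<pi>\<in>decks m n. X \<pi> - \<mu>)"
    unfolding up_def dn_def sum.distrib[symmetric] by (intro sum.cong) auto
  moreover have "up - dn = (\<Sum>\<pi>\<in>decks m n. \<bar>X \<pi> - \<mu>\<bar>)"
    unfolding up_def dn_def sum_subtractf[symmetric] by (intro sum.cong) auto
  ultimately have up: "up \<ge> K * (15 / 128 * sqrt m)" and dn: "dn = - up"
    using mean dev by auto
  \<comment> \<open>The constant 1/40 leaves room: 15/128 is larger, and the factor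
    \<open>q \<ge> 1\<close> only helps.\<close>
  have "K * (1 / 40 * sqrt m) \<le> K * (15 / 128 * sqrt m)"
    using K by (intro mult_left_mono) auto
  also have "\<dots> \<le> up" by (rule up)
  also have "\<dots> \<le> q * up"
    using q order_trans[OF _ up] K mult_right_mono[of 1 q up] by simp
  finally have gain: "1 / 40 * sqrt m \<le> q * up / K"
    using K by (simp add: field_simps)

  have score: "expected_score m n (switch_strategy m n T P) =
      m + q * (\<Sum>\<pi>\<in>decks m n. of_bool (P (count_list (take T \<pi>) 1)) * (X \<pi> - \<mu>)) / K" for P
    using sum_decks_score_switch_strategy[OF T, of P] n8 K
    by (simp add: expected_score_eq_sum X_def \<mu>_def q_def K_def add_divide_distrib)
  define opt where "opt = switch_strategy m n T (\<lambda>x. real x > \<mu>)"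
  define mis where "mis = switch_strategy m n T (\<lambda>x. real x < \<mu>)"
  have "expected_score m n opt = m + q * up / K"
    unfolding opt_def score up_def using X by (simp cong: sum.cong)
  moreover have "expected_score m n mis = m + q * dn / K"
    unfolding mis_def score dn_def using X by (simp cong: sum.cong)
  moreover have "opt \<in> strategies m n" "mis \<in> strategies m n"
    using n8 by (auto simp: opt_def mis_def intro!: switch_strategy_in_strategies)
  then have "Max (expected_score m n ` strategies m n) \<ge> expected_score m n opt"
    "Min (expected_score m n ` strategies m n) \<le> expected_score m n mis"
    using finite_strategies by auto
  \<comment> \<open>The misere loss equals the gain of the other game, so one estimate settles both
    claims.\<close>
  moreover have "q * dn / K = - (q * up / K)" by (simp add: dn)
  ultimately show ?thesis using gain by (intro conjI) linarith+
qed

end
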